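(* Let $\phi_\infty$ be the $\mathcal{BC}c$-formula in the variables $r_0,r_1,r_2,r_3,r'_0,r'_1,r'_2,r'_3,t$ that is the conjunction of the following formulas, where all indices are taken modulo 4 and $[k]$ denotes $k \bmod 4$: (1) $r_0+r_1+r_2+r_3=1$, $r_i\cdot r_j=0$ for $0\le i<j\le 3$, $r_i\neq 0$ for $0\le i\le 3$, $\neg C(r_0,r_2)$ and $\neg C(r_1,r_3)$; (2) $r'_i\neq 0$ and $r'_i\le r_i$ for $0\le i\le 3$, and $t\neq 0$; (3) $c(r'_i+r_{[i+1]}+t)$ for $0\le i\le 3$; (4) $\neg C(r'_i,t)$ for $0\le i\le 3$; (5) $\neg C\bigl(r'_i,\ r_{[i+1]}\cdot(-r'_{[i+1]})\bigr)$ for $0\le i\le 3$. Then $\phi_\infty$ is satisfiable over ${\sf RC}(\mathbb{R}^n)$ for every $n\ge 2$. On the other hand, if $T$ is a locally connected, unicoherent topological space, then in any interpretation over $(T,{\sf RC}(T))$ satisfying $\phi_\infty$, at least one of the variables is assigned a set having infinitely many connected components.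
   Context: For a topological space $T$, ${\sf RC}(T)$ is the set of regular closed subsets of $T$ (sets equal to the closure of their interior); it is a Boolean algebra with $X+Y=X\cup Y$, $X\cdot Y=\overline{\mathrm{int}(X\cap Y)}$, $-X=\overline{T\setminus X}$, $0=\emptyset$, $1=T$, and order $\subseteq$. Terms are built from variables using $+,\cdot,-,0,1$. The language $\mathcal{BC}c$ has atomic formulas $\tau_1=\tau_2$, $C(\tau_1,\tau_2)$ and $c(\tau)$, closed under $\wedge,\vee,\neg$; $\tau\neq 0$ abbreviates $\neg(\tau=0)$ and $\tau_1\le\tau_2$ abbreviates $\tau_1\cdot\tau_2=\tau_1$. An interpretation over $(T,{\sf RC}(T))$ assigns an element of ${\sf RC}(T)$ to each variable; terms are evaluated in the Boolean algebra; $\tau_1=\tau_2$ holds iff the values are equal, $C(\tau_1,\tau_2)$ holds iff the values have nonempty intersection, and $c(\tau)$ holds iff the value is connected (in the subspace topology). A formula is satisfiable over ${\sf RC}(\mathbb{R}^n)$ if some interpretation over $(\mathbb{R}^n,{\sf RC}(\mathbb{R}^n))$ makes it true. A space is locally connected if every neighbourhood of every point includes a connected neighbourhood of that point; $T$ is unicoherent if for any closed connected $X_1,X_2$ with $T=X_1\cup X_2$, the set $X_1\cap X_2$ is connected. *)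

theory Defs
  imports "HOL-Analysis.Analysis"
begin

definition regular_closed_in :: "'a topology \<Rightarrow> 'a set \<Rightarrow> bool" where
  "regular_closed_in X S \<longleftrightarrow> S = X closure_of (X interior_of S)"

definition rc_plus :: "'a set \<Rightarrow> 'a set \<Rightarrow> 'a set" where
  "rc_plus S T = S \<union> T"

definition rc_times :: "'a topology \<Rightarrow> 'a set \<Rightarrow> 'a set \<Rightarrow> 'a set" where
  "rc_times X S T = X closure_of (X interior_of (S \<inter> T))"

definition rc_minus :: "'a topology \<Rightarrow> 'a set \<Rightarrow> 'a set" where
  "rc_minus X S = X closure_of (topspace X - S)"

definition rc_le :: "'a topology \<Rightarrow> 'a set \<Rightarrow> 'a set \<Rightarrow> bool" where
  "rc_le X S T \<longleftrightarrow> rc_times X S T = S"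

definition rc_contact :: "'a set \<Rightarrow> 'a set \<Rightarrow> bool" where
  "rc_contact S T \<longleftrightarrow> S \<inter> T \<noteq> {}"

definition rc_conn :: "'a topology \<Rightarrow> 'a set \<Rightarrow> bool" where
  "rc_conn X S \<longleftrightarrow> connectedin X S"

definition unicoherent_space :: "'a topology \<Rightarrow> bool" where
  "unicoherent_space X \<longleftrightarrow>
     (\<forall>X1 X2. closedin X X1 \<and> closedin X X2 \<and> connectedin X X1 \<and> connectedin X X2
        \<and> topspace X = X1 \<union> X2 \<longrightarrow> connectedin X (X1 \<inter> X2))"

definition rc_interp :: "'a topology \<Rightarrow> (nat \<Rightarrow> 'a set) \<Rightarrow> (nat \<Rightarrow> 'a set) \<Rightarrow> 'a set \<Rightarrow> bool" where
  "rc_interp X r r' t \<longleftrightarrow>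
     (\<forall>i<4. regular_closed_in X (r i)) \<and> (\<forall>i<4. regular_closed_in X (r' i)) \<and>
     regular_closed_in X t"

definition phi_infty :: "'a topology \<Rightarrow> (nat \<Rightarrow> 'a set) \<Rightarrow> (nat \<Rightarrow> 'a set) \<Rightarrow> 'a set \<Rightarrow> bool" where
  "phi_infty X r r' t \<longleftrightarrow>
     \<comment> \<open>(1)\<close>
     rc_plus (rc_plus (rc_plus (r 0) (r 1)) (r 2)) (r 3) = topspace X \<and>
     (\<forall>i j. i < j \<and> j \<le> 3 \<longrightarrow> rc_times X (r i) (r j) = {}) \<and>
     (\<forall>i\<le>3. r i \<noteq> {}) \<and>
     \<not> rc_contact (r 0) (r 2) \<and> \<not> rc_contact (r 1) (r 3) \<and>
     \<comment> \<open>(2)\<close>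
     (\<forall>i\<le>3. r' i \<noteq> {} \<and> rc_le X (r' i) (r i)) \<and> t \<noteq> {} \<and>
     \<comment> \<open>(3)\<close>
     (\<forall>i\<le>3. rc_conn X (rc_plus (rc_plus (r' i) (r ((i + 1) mod 4))) t)) \<and>
     \<comment> \<open>(4)\<close>
     (\<forall>i\<le>3. \<not> rc_contact (r' i) t) \<and>
     \<comment> \<open>(5)\<close>
     (\<forall>i\<le>3. \<not> rc_contact (r' i)
                 (rc_times X (r ((i + 1) mod 4)) (rc_minus X (r' ((i + 1) mod 4)))))"

end

theory Submission
  imports Defs
begin

text \<open>
  If all variables had finitely many components, the components of the \<open>r\<^sub>i\<close> would form a finite closed
  cover without triple intersections, whose nerve is a tree by unicoherence. Conditions (3)--(5) force
  every component of \<open>r'\<^sub>i\<close> to touch a component of \<open>r'\<^sub>[\<^sub>i\<^sub>+\<^sub>1\<^sub>]\<close>. This produces an infinite walk in the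
  nerve along \<open>r\<^sub>0, r\<^sub>1, r\<^sub>2, r\<^sub>3, r\<^sub>0, \<dots>\<close>, which never backtracks as opposite colours are not in
  contact; a finite tree has no such walk.

  In \<open>\<real>\<^sup>n\<close>, with two coordinates \<open>u\<close> and \<open>v\<close>, colour the strips \<open>k \<le> u \<le> k + 1\<close> (\<open>k \<in> \<int>\<close>) by
  \<open>k mod 4\<close>, let \<open>r'\<close> consist of the parts \<open>v \<ge> -k\<close>, whose lower ends descend with \<open>k\<close>, and
  let \<open>t\<close> be the half-space \<open>u + v \<le> -1\<close> below all of them.
\<close>

section \<open>Finite closed covers of unicoherent spaces and their nerves\<close>

text \<open>This is the nerve of \<open>V\<close> with the vertex \<open>A\<close> deleted; its
  reflexive transitive closure describes the components that remain.\<close>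

definition avoiding_edges :: "'a set set \<Rightarrow> 'a set \<Rightarrow> ('a set \<times> 'a set) set" where
  "avoiding_edges V A = {(C, D). C \<in> V - {A} \<and> D \<in> V - {A} \<and> C \<inter> D \<noteq> {}}"

lemma avoiding_edges_rtrancl_in:
  "(B, C) \<in> (avoiding_edges V A)\<^sup>* \<Longrightarrow> B \<in> V - {A} \<Longrightarrow> C \<in> V - {A}"
  by (induction rule: rtrancl_induct) (auto simp: avoiding_edges_def)

text \<open>Every reachable \<open>C\<close> is joined to \<open>B\<close> by a chain of overlapping
  connected members. The unions of these chains are connected and all contain the nonempty set
  \<open>B\<close>.\<close>

lemma connectedin_Union_avoiding:
  assumes conn: "\<And>C. C \<in> V \<Longrightarrow> connectedin X C"
    and B: "B \<in> V - {A}" "B \<noteq> {}"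
  shows "connectedin X (\<Union>{C. (B, C) \<in> (avoiding_edges V A)\<^sup>*})" (is "connectedin X (\<Union>?K)")
proof -
  have chain: "\<exists>S. connectedin X S \<and> B \<subseteq> S \<and> C \<subseteq> S \<and> S \<subseteq> \<Union>?K"
    if "(B, C) \<in> (avoiding_edges V A)\<^sup>*" for C
    using that
  proof (induction rule: rtrancl_induct)
    case base
    then show ?case using conn B by blast
  next
    case (step C D)
    obtain S where S: "connectedin X S" "B \<subseteq> S" "C \<subseteq> S" "S \<subseteq> \<Union>?K"
      using step.IH by blast
    have "D \<in> V" "C \<inter> D \<noteq> {}"
      using step.hyps(2) by (auto simp: avoiding_edges_def)
    then have "connectedin X (S \<union> D)"
      using S conn by (intro connectedin_Un) auto
    moreover have "D \<in> ?K" using step.hyps by auto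
    ultimately show ?case using S by (intro exI[of _ "S \<union> D"]) blast
  qed
  let ?F = "{S. connectedin X S \<and> B \<subseteq> S \<and> S \<subseteq> \<Union>?K}"
  have "connectedin X (\<Union>?F)"
    using B(2) by (intro connectedin_Union) auto
  moreover have "\<Union>?F = \<Union>?K"
  proof (intro equalityI Union_least)
    show "S \<subseteq> \<Union>?K" if "S \<in> ?F" for S using that by blast
    show "C \<subseteq> \<Union>?F" if "C \<in> ?K" for C using chain[of C] that by blast
  qed
  ultimately show ?thesis by simp
qed

lemma connectedin_closed_cases:
  assumes "connectedin X S" "closedin X P" "closedin X Q" "S \<subseteq> P \<union> Q" "P \<inter> Q \<inter> S = {}"
  shows "P \<inter> S = {} \<or> Q \<inter> S = {}"
  using assms unfolding connectedin_closedin by blast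

text \<open>This is the tree property of the nerve. If \<open>B\<close> and \<open>B'\<close> stayed
  joined after deleting \<open>A\<close>, let \<open>K\<close> be their component. Then
  \<open>\<Union>K\<close> and the union of the other members are closed, connected and cover the
  space, so unicoherence makes their intersection \<open>A \<inter> \<Union>K\<close> connected. As
  triple intersections vanish, \<open>B\<close> and the rest of \<open>K\<close>, which contains
  \<open>B'\<close>, split it.\<close>

lemma unicoherent_neighbours_separated:
  assumes uni: "unicoherent_space X" and conX: "connected_space X"
    and fin: "finite V" and cover: "\<Union>V = topspace X"
    and closed: "\<And>C. C \<in> V \<Longrightarrow> closedin X C"
    and conn: "\<And>C. C \<in> V \<Longrightarrow> connectedin X C"
    and triple: "\<And>A B C. \<lbrakk>A \<in> V; B \<in> V; C \<in> V; A \<noteq> B; A \<noteq> C; B \<noteq> C\<rbrakk> \<Longrightarrow> A \<inter> B \<inter> C = {}"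
    and A: "A \<in> V" and B: "B \<in> V" and B': "B' \<in> V"
    and ne: "A \<noteq> B" "A \<noteq> B'" "B \<noteq> B'"
    and meet: "A \<inter> B \<noteq> {}" "A \<inter> B' \<noteq> {}"
  shows "(B, B') \<notin> (avoiding_edges V A)\<^sup>*"
proof
  assume path: "(B, B') \<in> (avoiding_edges V A)\<^sup>*"
  define K where "K = {C. (B, C) \<in> (avoiding_edges V A)\<^sup>*}"
  have KV: "K \<subseteq> V - {A}"
    using avoiding_edges_rtrancl_in B ne unfolding K_def by blast
  have BK: "B \<in> K" "B' \<in> K" using path by (auto simp: K_def)
  have sep: "C \<inter> D = {}" if "C \<in> K" "D \<in> V - K" "D \<noteq> A" for C D
  proof (rule ccontr)
    assume "C \<inter> D \<noteq> {}"
    then have "(C, D) \<in> avoiding_edges V A"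
      using that KV by (auto simp: avoiding_edges_def)
    then have "D \<in> K" using that(1) unfolding K_def by (auto intro: rtrancl_into_rtrancl)
    then show False using that by blast
  qed
  have cl: "closedin X (\<Union>W)" if "W \<subseteq> V" for W
    using that fin closed by (intro closedin_Union) (auto intro: finite_subset)
  have con1: "connectedin X (\<Union>K)"
    unfolding K_def using conn B ne meet(1) by (intro connectedin_Union_avoiding) auto
  have AX2: "A \<in> V - K" using A KV by blast
  \<comment> \<open>The connected set \<open>A\<close> lies on one side of any separation. The other
    side misses \<open>A\<close>, hence also \<open>\<Union>K\<close> by \<open>sep\<close>, so
    adding \<open>\<Union>K\<close> to the side of \<open>A\<close> would separate the whole
    space.\<close>
  have con2: "connectedin X (\<Union>(V - K))"
  proof -
    have no_split: False
      if E: "closedin X P" "closedin X Q" "\<Union>(V - K) \<subseteq> P \<union> Q" "P \<inter> Q \<inter> \<Union>(V - K) = {}"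
        "Q \<inter> \<Union>(V - K) \<noteq> {}" and AP: "A \<inter> Q = {}" for P Q
    proof -
      let ?P = "\<Union>K \<union> (P \<inter> \<Union>(V - K))" and ?Q = "Q \<inter> \<Union>(V - K)"
      have "closedin X ?P" "closedin X ?Q"
        using E KV by (auto intro!: closedin_Un closedin_Int cl)
      moreover have top: "topspace X \<subseteq> ?P \<union> ?Q" using E(3) cover by blast
      moreover have disj: "?P \<inter> ?Q \<inter> topspace X = {}" using E(4) sep AP by blast
      moreover have "connectedin X (topspace X)" using conX by (simp add: connectedin_topspace)
      ultimately have "?P \<inter> topspace X = {} \<or> ?Q \<inter> topspace X = {}"
        by (intro connectedin_closed_cases)
      moreover have "B \<subseteq> ?P" "B \<noteq> {}" "B \<subseteq> topspace X" "?Q \<subseteq> topspace X"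
        using BK meet cover B by blast+
      ultimately show False using E(5) by blast
    qed
    show ?thesis
      unfolding connectedin_closedin
    proof (intro conjI notI)
      show "\<Union>(V - K) \<subseteq> topspace X" using cover by blast
    next
      assume "\<exists>P Q. closedin X P \<and> closedin X Q \<and> \<Union>(V - K) \<subseteq> P \<union> Q \<and>
        P \<inter> Q \<inter> \<Union>(V - K) = {} \<and> P \<inter> \<Union>(V - K) \<noteq> {} \<and> Q \<inter> \<Union>(V - K) \<noteq> {}"
      then obtain P Q where E: "closedin X P" "closedin X Q" "\<Union>(V - K) \<subseteq> P \<union> Q"
        "P \<inter> Q \<inter> \<Union>(V - K) = {}" "P \<inter> \<Union>(V - K) \<noteq> {}" "Q \<inter> \<Union>(V - K) \<noteq> {}"
        by blast
      have "A \<subseteq> P \<union> Q" "P \<inter> Q \<inter> A = {}" using E AX2 by blast+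
      then have "A \<inter> P = {} \<or> A \<inter> Q = {}"
        using connectedin_closed_cases[OF conn[OF A] E(1,2)] by blast
      then show False
      proof
        assume "A \<inter> Q = {}"
        then show False using no_split[of P Q] E by blast
      next
        assume "A \<inter> P = {}"
        then show False using no_split[of Q P] E by blast
      qed
    qed
  qed
  have "connectedin X (\<Union>K \<inter> \<Union>(V - K))"
  proof -
    have "topspace X = \<Union>K \<union> \<Union>(V - K)" using cover KV by blast
    moreover have "closedin X (\<Union>K)" "closedin X (\<Union>(V - K))"
      using KV by (auto intro!: cl)
    ultimately show ?thesis
      using uni con1 con2 unfolding unicoherent_space_def by blast
  qed
  moreover have inter: "\<Union>K \<inter> \<Union>(V - K) = A \<inter> \<Union>K" using sep AX2 by blast
  ultimately have "connectedin X (A \<inter> \<Union>K)" by simp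
  moreover have "closedin X B" "closedin X (\<Union>(K - {B}))"
    using closed[OF B] KV by (auto intro!: cl)
  moreover have "A \<inter> \<Union>K \<subseteq> B \<union> \<Union>(K - {B})" by blast
  moreover have "B \<inter> \<Union>(K - {B}) \<inter> (A \<inter> \<Union>K) = {}"
    using triple[OF A B] KV ne by blast
  moreover have "B \<inter> (A \<inter> \<Union>K) \<noteq> {}" using BK meet by blast
  moreover have "\<Union>(K - {B}) \<inter> (A \<inter> \<Union>K) \<noteq> {}" using BK meet ne by blast
  ultimately show False using connectedin_closed_cases by blast
qed

text \<open>Let \<open>K n\<close> be the branch that the walk enters on leaving \<open>Z n\<close>.
  In a tree, a walk without backtracking enters strictly smaller branches forever, which is
  impossible in a finite nerve.\<close>

lemma unicoherent_no_infinite_walk: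
  assumes uni: "unicoherent_space X" and conX: "connected_space X"
    and fin: "finite V" and cover: "\<Union>V = topspace X"
    and closed: "\<And>C. C \<in> V \<Longrightarrow> closedin X C"
    and conn: "\<And>C. C \<in> V \<Longrightarrow> connectedin X C"
    and triple: "\<And>A B C. \<lbrakk>A \<in> V; B \<in> V; C \<in> V; A \<noteq> B; A \<noteq> C; B \<noteq> C\<rbrakk> \<Longrightarrow> A \<inter> B \<inter> C = {}"
    and Z: "\<And>n. Z n \<in> V" "\<And>n. Z n \<inter> Z (Suc n) \<noteq> {}"
      "\<And>n. Z n \<noteq> Z (Suc n)" "\<And>n. Z n \<noteq> Z (Suc (Suc n))"
  shows False
proof -
  define K where "K n = {C. (Z (Suc n), C) \<in> (avoiding_edges V (Z n))\<^sup>*}" for n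
  have KV: "K n \<subseteq> V - {Z n}" for n
    using avoiding_edges_rtrancl_in[of "Z (Suc n)" _ V "Z n"] Z(1)[of "Suc n"] Z(3)[of n]
    unfolding K_def by auto
  \<comment> \<open>\<open>Z n\<close> and \<open>Z (Suc (Suc n))\<close> are distinct neighbours of
    \<open>Z (Suc n)\<close>, so deleting the latter separates them.\<close>
  have no_return: "Z n \<notin> K (Suc n)" for n
  proof -
    have "(Z (Suc (Suc n)), Z n) \<notin> (avoiding_edges V (Z (Suc n)))\<^sup>*"
      using Z(2)[of n] Z(2)[of "Suc n"] Z(3)[of n] Z(3)[of "Suc n"] Z(4)[of n]
      by (intro unicoherent_neighbours_separated[OF uni conX fin cover closed conn triple] Z(1))
        auto
    then show ?thesis by (simp add: K_def)
  qed
  \<comment> \<open>By \<open>no_return\<close>, a path inside \<open>K (Suc n)\<close> never visits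
    \<open>Z n\<close>, so it can be prolonged backwards to \<open>Z (Suc n)\<close> while avoiding
    \<open>Z n\<close>.\<close>
  have sub: "K (Suc n) \<subseteq> K n" for n
  proof
    fix C assume "C \<in> K (Suc n)"
    then have "(Z (Suc (Suc n)), C) \<in> (avoiding_edges V (Z (Suc n)))\<^sup>*"
      by (simp add: K_def)
    then show "C \<in> K n"
    proof (induction rule: rtrancl_induct)
      case base
      have "(Z (Suc n), Z (Suc (Suc n))) \<in> avoiding_edges V (Z n)"
        using Z(1) Z(2)[of "Suc n"] Z(3)[of n] Z(4)[of n] unfolding avoiding_edges_def by auto
      then show ?case by (auto simp: K_def)
    next
      case (step C D)
      have "C \<in> K (Suc n)" "D \<in> K (Suc n)"
        using step.hyps by (auto simp: K_def)
      then have "C \<noteq> Z n" "D \<noteq> Z n" using no_return by auto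
      then have "(C, D) \<in> avoiding_edges V (Z n)"
        using step.hyps(2) by (auto simp: avoiding_edges_def)
      with step.IH show ?case by (auto simp: K_def intro: rtrancl_into_rtrancl)
    qed
  qed
  have finK: "finite (K n)" for n using KV fin by (meson finite_Diff finite_subset)
  have "K (Suc n) \<subset> K n" for n
  proof -
    have "Z (Suc n) \<in> K n" by (simp add: K_def)
    moreover have "Z (Suc n) \<notin> K (Suc n)" using KV by blast
    ultimately show ?thesis using sub by blast
  qed
  then have less: "card (K (Suc n)) < card (K n)" for n
    using finK psubset_card_mono by blast
  have "card (K n) + n \<le> card (K 0)" for n
  proof (induction n)
    case (Suc n)
    then show ?case using less[of n] by linarith
  qed simp
  from this[of "Suc (card (K 0))"] show False by simp
qed

section \<open>Order and complement in the algebra of regular closed sets\<close>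

lemma regular_closed_in_closedin: "regular_closed_in X S \<Longrightarrow> closedin X S"
  unfolding regular_closed_in_def by (metis closedin_closure_of)

lemma rc_le_subset:
  assumes "rc_le X S T" "regular_closed_in X T"
  shows "S \<subseteq> T"
proof -
  have "X closure_of (X interior_of (S \<inter> T)) \<subseteq> T"
    using regular_closed_in_closedin[OF assms(2)]
    by (meson Int_lower2 closure_of_minimal interior_of_subset subset_trans)
  then show ?thesis using assms(1) by (simp add: rc_le_def rc_times_def)
qed

text \<open>The open set \<open>X interior_of R - S\<close> lies in the product, so the closed
  right-hand side contains the interior of \<open>R\<close> and hence its closure \<open>R\<close>.
  With condition (5), this forces points common to \<open>r' i\<close> and the next \<open>r\<close>
  into the next \<open>r'\<close>.\<close>

lemma regular_closed_in_split:
  assumes R: "regular_closed_in X R" and S: "closedin X S"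
  shows "R \<subseteq> S \<union> rc_times X R (rc_minus X S)"
proof -
  have "X interior_of R - S \<subseteq> R \<inter> X closure_of (topspace X - S)"
    using interior_of_subset[of X R] interior_of_subset_topspace[of X R]
      closure_of_subset[of "topspace X - S" X] by blast
  moreover have "openin X (X interior_of R - S)"
    using S by (intro openin_diff) auto
  ultimately have "X interior_of R - S \<subseteq> X interior_of (R \<inter> X closure_of (topspace X - S))"
    by (rule interior_of_maximal)
  then have "X interior_of R - S \<subseteq> rc_times X R (rc_minus X S)"
    unfolding rc_times_def rc_minus_def
    by (meson closure_of_subset interior_of_subset_topspace subset_trans)
  then have "X interior_of R \<subseteq> S \<union> rc_times X R (rc_minus X S)" by blast
  moreover have "closedin X (S \<union> rc_times X R (rc_minus X S))"
    using S by (intro closedin_Un) (auto simp: rc_times_def)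
  ultimately have "X closure_of (X interior_of R) \<subseteq> S \<union> rc_times X R (rc_minus X S)"
    by (rule closure_of_minimal)
  then show ?thesis using R by (simp add: regular_closed_in_def)
qed

section \<open>Infinitely many components in unicoherent spaces\<close>

text \<open>Finiteness enters twice: for the \<open>r i\<close> it makes the cover \<open>V\<close>
  finite, and for the \<open>r' i\<close> it makes the union of all components but one
  closed.\<close>

lemma phi_infty_infinite_components:
  assumes uni: "unicoherent_space X" and I: "rc_interp X r r' t" and phi: "phi_infty X r r' t"
  shows "\<exists>S \<in> r ` {..3} \<union> r' ` {..3} \<union> {t}. infinite (connected_components_of (subtopology X S))"
proof (rule ccontr)
  assume "\<not> ?thesis"
  then have fin: "finite (connected_components_of (subtopology X (r i)))"
      "finite (connected_components_of (subtopology X (r' i)))" if "i < 4" for i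
    using that by auto
  have le3: "i \<le> 3 \<longleftrightarrow> i < 4" for i :: nat by auto
  note phi' = phi[unfolded phi_infty_def rc_plus_def rc_contact_def rc_conn_def le3]
  have cover: "r 0 \<union> r 1 \<union> r 2 \<union> r 3 = topspace X"
    and opposite: "\<not> r 0 \<inter> r 2 \<noteq> {}" "\<not> r 1 \<inter> r 3 \<noteq> {}"
    and all_r': "\<forall>i<4. r' i \<noteq> {} \<and> rc_le X (r' i) (r i)" and t_ne: "t \<noteq> {}"
    and all_con: "\<forall>i<4. connectedin X (r' i \<union> r ((i + 1) mod 4) \<union> t)"
    and all_t: "\<forall>i<4. \<not> r' i \<inter> t \<noteq> {}"
    and all_far: "\<forall>i<4. \<not> r' i \<inter> rc_times X (r ((i + 1) mod 4)) (rc_minus X (r' ((i + 1) mod 4))) \<noteq> {}"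
    using phi' by - (elim conjE, assumption)+
  have r'_ne: "r' i \<noteq> {}" and r'_le: "rc_le X (r' i) (r i)"
    and con: "connectedin X (r' i \<union> r ((i + 1) mod 4) \<union> t)"
    and r't: "r' i \<inter> t = {}"
    and r'r: "r' i \<inter> rc_times X (r ((i + 1) mod 4)) (rc_minus X (r' ((i + 1) mod 4))) = {}"
    if "i < 4" for i
    using all_r' all_con all_t all_far that by simp_all
  have rcr: "regular_closed_in X (r i)" and clr: "closedin X (r i)" and clr': "closedin X (r' i)"
    if "i < 4" for i
    using I that by (auto simp: rc_interp_def intro: regular_closed_in_closedin)
  have clt: "closedin X t" using I by (auto simp: rc_interp_def intro: regular_closed_in_closedin)
  have sub: "r' i \<subseteq> r i" if "i < 4" for i
    using rc_le_subset[OF r'_le[OF that] rcr[OF that]] .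
  \<comment> \<open>The four connected sets of (3) share the nonempty \<open>t\<close>. They cover
    the space because \<open>r i\<close> occurs in the one with index \<open>i - 1\<close>, written
    \<open>(i + 3) mod 4\<close>.\<close>
  have conX: "connected_space X"
  proof -
    let ?W = "\<lambda>i. r' i \<union> r ((i + 1) mod 4) \<union> t"
    have "connectedin X (\<Union>(?W ` {..<4}))"
      using con t_ne by (intro connectedin_Union) auto
    moreover have "\<Union>(?W ` {..<4}) = topspace X"
    proof
      show "\<Union>(?W ` {..<4}) \<subseteq> topspace X"
        using con connectedin_subset_topspace by blast
      have "r i \<subseteq> \<Union>(?W ` {..<4})" if "i < 4" for i
      proof -
        have "((i + 3) mod 4 + 1) mod 4 = i" using that by presburger
        then have "r i \<subseteq> ?W ((i + 3) mod 4)" by auto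
        moreover have "(i + 3) mod 4 \<in> {..<4}" by simp
        ultimately show ?thesis by blast
      qed
      from this[of 0] this[of 1] this[of 2] this[of 3]
      show "topspace X \<subseteq> \<Union>(?W ` {..<4})"
        unfolding cover[symmetric] by (intro Un_least) simp_all
    qed
    ultimately show ?thesis by (simp add: connectedin_topspace)
  qed

  define V where "V = (\<Union>i<4. connected_components_of (subtopology X (r i)))"
  have finV: "finite V" using fin by (auto simp: V_def)
  have r_sub: "r i \<subseteq> topspace X" if "i < 4" for i
    using clr[OF that] closedin_subset by blast
  have comps: "\<Union>(connected_components_of (subtopology X S)) = S" if "closedin X S" for S
    using that closedin_subset by (auto simp: Union_connected_components_of)
  have less4: "i < 4 \<longleftrightarrow> i = 0 \<or> i = 1 \<or> i = 2 \<or> i = (3::nat)" for i by auto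
  have coverV: "\<Union>V = topspace X"
  proof -
    have "\<Union>V = (\<Union>i<4. \<Union>(connected_components_of (subtopology X (r i))))"
      unfolding V_def by blast
    also have "\<dots> = (\<Union>i<4. r i)"
      using comps[OF clr] by (intro SUP_cong) auto
    also have "\<dots> = topspace X"
    proof -
      have "{..<4} = {0, 1, 2, 3 :: nat}" by auto
      then show ?thesis using cover by (simp add: Un_assoc)
    qed
    finally show ?thesis .
  qed
  have closed_comp: "closedin X C"
    if "C \<in> connected_components_of (subtopology X S)" "closedin X S" for C S
    using that closedin_connected_components_of closedin_trans_full by blast
  have clV: "closedin X C" if "C \<in> V" for C
    using that closed_comp clr by (auto simp: V_def)
  have conV: "connectedin X C" if "C \<in> V" for C
    using that unfolding V_def
    by (auto dest!: connectedin_connected_components_of simp: connectedin_subtopology)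
  have comp_eq: "A = B" if "A \<in> connected_components_of (subtopology X (r i))"
    "B \<in> connected_components_of (subtopology X (r i))" "x \<in> A" "x \<in> B" for A B i x
    using that connected_components_of_overlap by fastforce
  have comp_sub: "A \<subseteq> S" if "A \<in> connected_components_of (subtopology X S)" for A S
    using connected_components_of_subset[OF that] by simp
  \<comment> \<open>Distinct components with a common point have distinct colours, and any three of
    the four colours include an opposite pair.\<close>
  have triple: "A \<inter> B \<inter> C = {}"
    if ABC: "A \<in> V" "B \<in> V" "C \<in> V" "A \<noteq> B" "A \<noteq> C" "B \<noteq> C" for A B C
  proof (rule ccontr)
    assume "A \<inter> B \<inter> C \<noteq> {}"
    then obtain x where x: "x \<in> A" "x \<in> B" "x \<in> C" by blast
    obtain i j k where ijk: "i < 4" "j < 4" "k < 4"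
      "A \<in> connected_components_of (subtopology X (r i))"
      "B \<in> connected_components_of (subtopology X (r j))"
      "C \<in> connected_components_of (subtopology X (r k))"
      using ABC(1-3) unfolding V_def by blast
    have "i \<noteq> j" "i \<noteq> k" "j \<noteq> k" using comp_eq ijk x ABC(4-6) by blast+
    moreover have "x \<in> r i" "x \<in> r j" "x \<in> r k" using comp_sub ijk x by blast+
    ultimately show False
      using ijk(1-3) opposite unfolding less4 by auto
  qed

  \<comment> \<open>Connectedness in (3) forces \<open>Y\<close> to meet the closed union of
    everything else, which contains \<open>t\<close> and so is nonempty. \<open>Y\<close> misses the
    other components of \<open>r' i\<close>, and misses \<open>t\<close> by (4), so it meets the
    next \<open>r\<close>; by (5) the meeting point lies in the next \<open>r'\<close>.\<close>
  have next_comp: "\<exists>Y'. Y' \<in> connected_components_of (subtopology X (r' ((i + 1) mod 4))) \<and> Y \<inter> Y' \<noteq> {}"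
    if i: "i < 4" and Y: "Y \<in> connected_components_of (subtopology X (r' i))" for i Y
  proof -
    let ?j = "(i + 1) mod 4"
    have j: "?j < 4" by simp
    let ?R = "\<Union>(connected_components_of (subtopology X (r' i)) - {Y})"
    have "closedin X ?R"
      using fin(2)[OF i] closed_comp clr'[OF i] by (intro closedin_Union) auto
    then have cl: "closedin X (?R \<union> r ?j \<union> t)"
      using clr[OF j] clt by (intro closedin_Un)
    have disj: "Y \<inter> ?R = {}"
      using pairwise_disjoint_connected_components_of[of "subtopology X (r' i)"] Y
      by (auto simp: pairwise_def disjnt_def)
    have sup: "r' i \<union> r ?j \<union> t \<subseteq> Y \<union> (?R \<union> r ?j \<union> t)"
      using comps[OF clr'[OF i]] by blast
    have Yne: "Y \<noteq> {}" using Y nonempty_connected_components_of by blast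
    have Ysub: "Y \<subseteq> r' i" using comp_sub Y by blast
    have "Y \<inter> (?R \<union> r ?j \<union> t) \<noteq> {}"
    proof
      assume "Y \<inter> (?R \<union> r ?j \<union> t) = {}"
      then show False
        using connectedin_closed_cases[OF con[OF i] closed_comp[OF Y clr'[OF i]] cl sup]
          Yne Ysub t_ne by blast
    qed
    then obtain x where x: "x \<in> Y" "x \<in> r ?j"
      using disj r't[OF i] Ysub by blast
    have "x \<in> r' ?j"
      using regular_closed_in_split[OF rcr[OF j] clr'[OF j]] x r'r[OF i] Ysub by blast
    then show ?thesis using comps[OF clr'[OF j]] x by blast
  qed
  have "\<exists>Y. \<forall>n. Y n \<in> connected_components_of (subtopology X (r' (n mod 4))) \<and> Y n \<inter> Y (Suc n) \<noteq> {}"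
  proof (rule dependent_nat_choice)
    show "\<exists>Y. Y \<in> connected_components_of (subtopology X (r' (0 mod 4)))"
      using comps[OF clr'[of 0]] r'_ne[of 0] by auto
  next
    fix Y n assume "Y \<in> connected_components_of (subtopology X (r' (n mod 4)))"
    from next_comp[OF _ this]
    show "\<exists>Y'. Y' \<in> connected_components_of (subtopology X (r' (Suc n mod 4))) \<and> Y \<inter> Y' \<noteq> {}"
      by (simp add: mod_Suc_eq)
  qed
  then obtain Y where Y: "\<And>n. Y n \<in> connected_components_of (subtopology X (r' (n mod 4)))"
    "\<And>n. Y n \<inter> Y (Suc n) \<noteq> {}" by blast
  \<comment> \<open>The walk through components of the \<open>r'\<close> is enlarged to components
    of the \<open>r\<close>, which are the vertices of the nerve.\<close>
  have "\<exists>Z. Z \<in> connected_components_of (subtopology X (r (n mod 4))) \<and> Y n \<subseteq> Z" for n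
  proof -
    have n: "n mod 4 < 4" by simp
    have "connectedin X (Y n)" "Y n \<subseteq> r' (n mod 4)"
      using connectedin_connected_components_of[OF Y(1)] by (auto simp: connectedin_subtopology)
    then have "connectedin (subtopology X (r (n mod 4))) (Y n)"
      using sub[OF n] by (auto simp: connectedin_subtopology)
    moreover have "topspace (subtopology X (r (n mod 4))) \<noteq> {}"
      using r'_ne[OF n] sub[OF n] r_sub[OF n] by auto
    then have "subtopology X (r (n mod 4)) \<noteq> trivial_topology"
      by (metis topspace_discrete_topology)
    ultimately show ?thesis
      using exists_connected_component_of_superset by blast
  qed
  then obtain Z where Z: "\<And>n. Z n \<in> connected_components_of (subtopology X (r (n mod 4)))"
    "\<And>n. Y n \<subseteq> Z n" by metis
  have meet: "Z n \<inter> Z (Suc n) \<noteq> {}" for n using Y(2)[of n] Z(2) by blast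
  have opp: "r (n mod 4) \<inter> r (Suc (Suc n) mod 4) = {}" for n
  proof -
    have "n mod 4 < 4" by simp
    then consider "n mod 4 = 0" | "n mod 4 = 1" | "n mod 4 = 2" | "n mod 4 = 3" by linarith
    then show ?thesis
      using opposite by cases (auto simp: mod_Suc numeral_2_eq_2 numeral_3_eq_3)
  qed
  have two: "Z n \<inter> Z (Suc (Suc n)) = {}" for n
    using comp_sub[OF Z(1)[of n]] comp_sub[OF Z(1)[of "Suc (Suc n)"]] opp[of n] by blast
  show False
  proof (rule unicoherent_no_infinite_walk[OF uni conX finV coverV clV conV triple])
    show "Z n \<in> V" for n using Z(1)[of n] by (auto simp: V_def intro!: bexI[of _ "n mod 4"])
    show "Z n \<inter> Z (Suc n) \<noteq> {}" for n by (rule meet)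
    \<comment> \<open>Equality would make \<open>Z n\<close> meet \<open>Z (Suc (Suc n))\<close>,
      which has the opposite colour.\<close>
    show "Z n \<noteq> Z (Suc n)" for n using meet[of "Suc n"] two[of n] by auto
    show "Z n \<noteq> Z (Suc (Suc n))" for n using meet[of n] two[of n] by auto
  qed
qed

section \<open>A model in Euclidean space\<close>

text \<open>The strips extend in both directions, so \<open>k\<close> is an integer, while the
  colour \<open>i\<close> is a natural number.\<close>

definition congruent_strips :: "nat \<Rightarrow> (int \<Rightarrow> 'a set) \<Rightarrow> 'a set" where
  "congruent_strips i F = (\<Union>k\<in>{k. k mod 4 = int i}. F k)"

text \<open>The family is locally finite: the open slab of points whose \<open>a\<close>-coordinate
  differs from \<open>x $ a\<close> by less than 1 meets only strips with index within 2 of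
  \<open>\<lfloor>x $ a\<rfloor>\<close>.\<close>

lemma closed_congruent_strips:
  fixes F :: "int \<Rightarrow> (real^'n) set"
  assumes "\<And>k. closed (F k)" and strip: "\<And>k. F k \<subseteq> {x. of_int k \<le> x $ a \<and> x $ a \<le> of_int k + 1}"
  shows "closed (congruent_strips i F)"
proof -
  have "closedin euclidean (\<Union>(F ` {k. k mod 4 = int i}))"
  proof (rule closedin_locally_finite_Union)
    show "locally_finite_in euclidean (F ` {k. k mod 4 = int i})"
      unfolding locally_finite_in_def
    proof (intro conjI ballI)
      fix x :: "real^'n"
      let ?U = "{y. y $ a < x $ a + 1} \<inter> {y. x $ a - 1 < y $ a}"
      have "open ?U"
        by (intro open_Int open_Collect_less continuous_intros)
      moreover
      have "{S \<in> F ` {k. k mod 4 = int i}. S \<inter> ?U \<noteq> {}} \<subseteq> F ` {\<lfloor>x $ a\<rfloor> - 2 .. \<lfloor>x $ a\<rfloor> + 2}"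
      proof
        fix S assume "S \<in> {S \<in> F ` {k. k mod 4 = int i}. S \<inter> ?U \<noteq> {}}"
        then obtain k y where y: "S = F k" "y \<in> F k" "y $ a < x $ a + 1" "x $ a - 1 < y $ a"
          by blast
        then have "of_int k \<le> y $ a" "y $ a \<le> of_int k + 1" using strip by blast+
        with y have "\<lfloor>x $ a\<rfloor> - 2 \<le> k" "k \<le> \<lfloor>x $ a\<rfloor> + 2" by linarith+
        with y show "S \<in> F ` {\<lfloor>x $ a\<rfloor> - 2 .. \<lfloor>x $ a\<rfloor> + 2}" by simp
      qed
      then have "finite {S \<in> F ` {k. k mod 4 = int i}. S \<inter> ?U \<noteq> {}}"
        by (rule finite_subset) simp
      ultimately show "\<exists>U. openin euclidean U \<and> x \<in> U \<and> finite {S \<in> F ` {k. k mod 4 = int i}. S \<inter> U \<noteq> {}}"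
        by (intro exI[of _ ?U] conjI) simp_all
    qed auto
  qed (use assms(1) in auto)
  then show ?thesis by (simp add: congruent_strips_def)
qed

lemma regular_closed_convex:
  fixes S :: "(real^'n) set"
  assumes "convex S" "closed S" "interior S \<noteq> {}"
  shows "closure (interior S) = S"
  using assms by (simp add: convex_closure_interior)

lemma regular_closed_congruent_strips:
  fixes F :: "int \<Rightarrow> (real^'n) set"
  assumes F: "\<And>k. closed (F k)" "\<And>k. convex (F k)" "\<And>k. interior (F k) \<noteq> {}"
    and strip: "\<And>k. F k \<subseteq> {x. of_int k \<le> x $ a \<and> x $ a \<le> of_int k + 1}"
  shows "regular_closed_in euclidean (congruent_strips i F)"
proof -
  let ?S = "congruent_strips i F"
  have "closure (interior ?S) \<subseteq> ?S"
    using closed_congruent_strips[OF F(1) strip] by (meson closure_minimal interior_subset)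
  moreover have "?S \<subseteq> closure (interior ?S)"
  proof -
    have "F k \<subseteq> closure (interior ?S)" if "k mod 4 = int i" for k
    proof -
      have "F k = closure (interior (F k))" using regular_closed_convex F by metis
      also have "\<dots> \<subseteq> closure (interior ?S)"
        using that by (intro closure_mono interior_mono) (auto simp: congruent_strips_def)
      finally show ?thesis .
    qed
    then show ?thesis unfolding congruent_strips_def by blast
  qed
  ultimately show ?thesis
    unfolding regular_closed_in_def by auto
qed

text \<open>A short step \<open>d\<close> along the axis stays in the ball, but \<open>d\<close>
  would be an integer strictly between 0 and 1. Strips with different indices overlap only in such
  points, so products of different colours vanish.\<close>

lemma interior_integer_coordinate: "interior {x :: real^'n. x $ a \<in> \<int>} = {}"
proof (rule ccontr)
  assume "interior {x :: real^'n. x $ a \<in> \<int>} \<noteq> {}"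
  then obtain x e where e: "e > 0" "ball x e \<subseteq> {x :: real^'n. x $ a \<in> \<int>}"
    by (auto simp: mem_interior)
  define d where "d = min (e/2) (1/2)"
  have d: "0 < d" "d < e" "d < 1" using e by (auto simp: d_def)
  have "axis a d = d *\<^sub>R axis a 1" by (simp add: axis_def vec_eq_iff)
  then have "norm (axis a d) = d" using d by (simp add: norm_axis_1)
  then have "x + axis a d \<in> ball x e" using d by (simp add: dist_norm)
  then have "x + axis a d \<in> {x. x $ a \<in> \<int>}" using e by blast
  then have "x $ a + d \<in> \<int>" by (simp add: axis_def)
  have "x \<in> ball x e" using e by simp
  then have "x $ a \<in> \<int>" using e by blast
  with \<open>x $ a + d \<in> \<int>\<close> have "d \<in> \<int>" by (metis Ints_diff add_diff_cancel_left')
  then show False using d by (auto elim!: Ints_cases)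
qed

text \<open>Near an interior point of \<open>R \<inter> closure (- S)\<close> there are always
  points of \<open>R - S\<close>, so this interior lies in the closure of
  \<open>R - S\<close>.\<close>

lemma rc_times_minus_subset:
  assumes "R - S \<subseteq> D" "closed D"
  shows "rc_times euclidean R (rc_minus euclidean S) \<subseteq> D"
proof -
  have "interior (R \<inter> closure (- S)) \<subseteq> D"
  proof
    fix y assume y: "y \<in> interior (R \<inter> closure (- S))"
    have "y \<in> closure (R - S)"
      unfolding closure_iff_nhds_not_empty
    proof (intro allI impI)
      fix A U assume U: "U \<subseteq> A" "open U" "y \<in> U"
      let ?W = "U \<inter> interior (R \<inter> closure (- S))"
      have "open ?W" using U by auto
      moreover have "y \<in> ?W" "y \<in> closure (- S)" using U y interior_subset by blast+
      ultimately have "- S \<inter> ?W \<noteq> {}" by (metis closure_iff_nhds_not_empty order_refl)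
      then show "(R - S) \<inter> A \<noteq> {}" using interior_subset U by blast
    qed
    then show "y \<in> D" using assms by (meson closure_minimal subsetD)
  qed
  then show ?thesis
    using assms(2) by (simp add: rc_times_def rc_minus_def closure_minimal Compl_eq_Diff_UNIV)
qed

lemma phi_infty_satisfiable:
  assumes "CARD('n) \<ge> 2"
  shows "\<exists>r r' t. rc_interp (euclidean :: (real^'n) topology) r r' t \<and> phi_infty euclidean r r' t"
proof -
  obtain a b :: 'n where ab: "a \<noteq> b"
    using assms by (metis UNIV_I card_le_Suc0_iff_eq finite not_less_eq_eq numeral_2_eq_2)
  define F :: "int \<Rightarrow> (real^'n) set"
    where "F k = {x. of_int k \<le> x $ a} \<inter> {x. x $ a \<le> of_int k + 1}" for k
  define F' where "F' k = F k \<inter> {x. - of_int k \<le> x $ b}" for k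
  \<comment> \<open>\<open>r\<^sub>i \<cdot> (- r'\<^sub>i)\<close> is contained in the union of the \<open>G k\<close> with \<open>k mod 4 = i\<close>.\<close>
  define G where "G k = F k \<inter> {x. x $ b \<le> - of_int k}" for k
  define r where "r i = congruent_strips i F" for i
  define r' where "r' i = congruent_strips i F'" for i
  define t where "t = {x :: real^'n. x $ b + x $ a \<le> - 1}"
  \<comment> \<open>Supplies test points with prescribed \<open>a\<close>- and
    \<open>b\<close>-coordinates.\<close>
  define p :: "real \<Rightarrow> real \<Rightarrow> real^'n" where "p u v = (\<chi> i. if i = a then u else v)" for u v
  have p [simp]: "p u v $ a = u" "p u v $ b = v" for u v using ab by (auto simp: p_def)
  have closed_F: "closed (F k)" "closed (F' k)" "closed (G k)" for k
    unfolding F_def F'_def G_def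
    by (intro closed_Int closed_Collect_le continuous_intros)+
  have closed_t: "closed t"
    unfolding t_def by (intro closed_Collect_le continuous_intros)
  have convex_coord: "convex {x :: real^'n. c \<le> x $ j}" "convex {x :: real^'n. x $ j \<le> c}" for c j
    using convex_halfspace_ge[of c "axis j (1::real)"] convex_halfspace_le[of "axis j (1::real)" c]
    by (auto simp: inner_axis' inner_axis)
  have convex_F: "convex (F k)" "convex (F' k)" for k
    unfolding F_def F'_def by (intro convex_Int convex_coord)+
  have convex_t: "convex t"
    unfolding t_def using convex_halfspace_le[of "axis a (1::real) + axis b 1" "-1"]
    by (auto simp: inner_axis' inner_add_left add.commute)
  have int_F': "interior (F' k) \<noteq> {}" for k
  proof -
    let ?U = "{x :: real^'n. of_int k < x $ a} \<inter> {x. x $ a < of_int k + 1} \<inter> {x. - of_int k < x $ b}"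
    have "?U \<subseteq> interior (F' k)"
      by (intro interior_maximal open_Int open_Collect_less continuous_intros)
        (auto simp: F'_def F_def)
    moreover have "p (of_int k + 1/2) (1 - of_int k) \<in> ?U" by simp
    ultimately show ?thesis by blast
  qed
  have int_F: "interior (F k) \<noteq> {}" for k
    using int_F'[of k] interior_mono[of "F' k" "F k"] by (auto simp: F'_def)
  have int_t: "interior t \<noteq> {}"
  proof -
    have "{x :: real^'n. x $ b + x $ a < - 1} \<subseteq> interior t"
      by (intro interior_maximal open_Collect_less continuous_intros) (auto simp: t_def)
    moreover have "p 0 (- 2) \<in> {x :: real^'n. x $ b + x $ a < - 1}" by simp
    ultimately show ?thesis by blast
  qed
  have strip: "F k \<subseteq> {x. of_int k \<le> x $ a \<and> x $ a \<le> of_int k + 1}"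
    "F' k \<subseteq> {x. of_int k \<le> x $ a \<and> x $ a \<le> of_int k + 1}"
    "G k \<subseteq> {x. of_int k \<le> x $ a \<and> x $ a \<le> of_int k + 1}" for k
    by (auto simp: F_def F'_def G_def)
  have rc_r: "regular_closed_in euclidean (r i)" for i
    unfolding r_def by (rule regular_closed_congruent_strips[OF closed_F(1) convex_F(1) int_F strip(1)])
  have rc_r': "regular_closed_in euclidean (r' i)" for i
    unfolding r'_def by (rule regular_closed_congruent_strips[OF closed_F(2) convex_F(2) int_F' strip(2)])
  have rc_t: "regular_closed_in euclidean t"
    using regular_closed_convex[OF convex_t closed_t int_t] by (simp add: regular_closed_in_def)
  have mem_r: "x \<in> r i \<longleftrightarrow> (\<exists>k. k mod 4 = int i \<and> of_int k \<le> x $ a \<and> x $ a \<le> of_int k + 1)" for x i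
    by (auto simp: r_def congruent_strips_def F_def)
  have mem_r': "x \<in> r' i \<longleftrightarrow> (\<exists>k. k mod 4 = int i \<and> of_int k \<le> x $ a \<and> x $ a \<le> of_int k + 1
      \<and> - of_int k \<le> x $ b)" for x i
    by (auto simp: r'_def congruent_strips_def F'_def F_def)
  have near: "k - 1 \<le> m \<and> m \<le> k + 1" if "of_int k \<le> (u::real)" "u \<le> of_int k + 1"
    "of_int m \<le> u" "u \<le> of_int m + 1" for k m u
    using that by linarith
  have sub: "r' i \<subseteq> r i" for i by (auto simp: mem_r mem_r')

  have cover: "r 0 \<union> r 1 \<union> r 2 \<union> r 3 = UNIV"
  proof -
    have "x \<in> r 0 \<union> r 1 \<union> r 2 \<union> r 3" for x
    proof -
      have "of_int \<lfloor>x $ a\<rfloor> \<le> x $ a" "x $ a \<le> of_int \<lfloor>x $ a\<rfloor> + 1" by linarith+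
      then have "x \<in> r i" if "\<lfloor>x $ a\<rfloor> mod 4 = int i" for i using that mem_r by blast
      moreover have "\<lfloor>x $ a\<rfloor> mod 4 = int 0 \<or> \<lfloor>x $ a\<rfloor> mod 4 = int 1 \<or> \<lfloor>x $ a\<rfloor> mod 4 = int 2 \<or> \<lfloor>x $ a\<rfloor> mod 4 = int 3"
        by (simp, presburger)
      ultimately show ?thesis by blast
    qed
    then show ?thesis by blast
  qed
  have times0: "rc_times euclidean (r i) (r j) = {}" if "i < j" for i j
  proof -
    have "r i \<inter> r j \<subseteq> {x. x $ a \<in> \<int>}"
    proof clarify
      fix x assume "x \<in> r i" "x \<in> r j"
      then obtain k m where km: "k mod 4 = int i" "of_int k \<le> x $ a" "x $ a \<le> of_int k + 1"
        "m mod 4 = int j" "of_int m \<le> x $ a" "x $ a \<le> of_int m + 1"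
        unfolding mem_r by blast
      have "k \<noteq> m" using km that by auto
      then have "x $ a = of_int k \<or> x $ a = of_int m" using near km by linarith
      then show "x $ a \<in> \<int>" by auto
    qed
    then have "interior (r i \<inter> r j) = {}"
      using interior_mono interior_integer_coordinate by (metis subset_empty)
    then show ?thesis by (simp add: rc_times_def)
  qed
  \<comment> \<open>Strips with a common point have indices at most 1 apart, so their difference is
    never 2 modulo 4.\<close>
  have opposite: "r i \<inter> r j = {}" if "(int j - int i) mod 4 = 2" for i j
  proof -
    have False if x: "x \<in> r i" "x \<in> r j" for x
    proof -
      obtain k m where km: "k mod 4 = int i" "of_int k \<le> x $ a" "x $ a \<le> of_int k + 1"
        "m mod 4 = int j" "of_int m \<le> x $ a" "x $ a \<le> of_int m + 1"
        using x unfolding mem_r by blast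
      have "k - 1 \<le> m \<and> m \<le> k + 1" using near km by blast
      moreover have "(m - k) mod 4 = 2"
        using \<open>(int j - int i) mod 4 = 2\<close> km(1,4) by (metis mod_diff_eq)
      ultimately show False by presburger
    qed
    then show ?thesis by blast
  qed
  have p_r': "p (real i) 0 \<in> r' i" if "i < 4" for i
    unfolding mem_r' using that by (intro exI[of _ "int i"]) auto
  have le: "rc_le euclidean (r' i) (r i)" for i
    using rc_r'[of i] sub[of i] by (simp add: rc_le_def rc_times_def regular_closed_in_def Int_absorb2)
  \<comment> \<open>On the piece with index \<open>k\<close> the two coordinates are at least
    \<open>k\<close> and \<open>-k\<close>, so their sum is at least 0.\<close>
  have r't: "r' i \<inter> t = {}" for i
    by (auto simp: mem_r' t_def)
  have conn: "connected (r' i \<union> r ((i + 1) mod 4) \<union> t)" if i: "i < 4" for i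
  proof -
    \<comment> \<open>Each piece \<open>F' k\<close> is grouped with the following strip and a copy
      of \<open>t\<close>; the groups are connected and share \<open>t\<close>.\<close>
    have eq: "r' i \<union> r ((i + 1) mod 4) \<union> t = \<Union>((\<lambda>k. F' k \<union> F (k + 1) \<union> t) ` {k. k mod 4 = int i})"
    proof -
      have "(\<exists>m. m mod 4 = int ((i + 1) mod 4) \<and> x \<in> F m) \<longleftrightarrow> (\<exists>k. k mod 4 = int i \<and> x \<in> F (k + 1))" for x
      proof safe
        fix m assume m: "m mod 4 = int ((i + 1) mod 4)" "x \<in> F m"
        then have "(m - 1) mod 4 = int i" using i by (simp add: zmod_int) presburger
        then show "\<exists>k. k mod 4 = int i \<and> x \<in> F (k + 1)" using m by (intro exI[of _ "m - 1"]) auto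
      next
        fix k assume k: "k mod 4 = int i" "x \<in> F (k + 1)"
        then have "(k + 1) mod 4 = int ((i + 1) mod 4)" using i by (simp add: zmod_int) presburger
        then show "\<exists>m. m mod 4 = int ((i + 1) mod 4) \<and> x \<in> F m" using k by blast
      qed
      \<comment> \<open>The index set must be nonempty for the union of the groups to contain
        \<open>t\<close>.\<close>
      moreover have "\<exists>k. k mod 4 = int i" using i by (intro exI[of _ "int i"]) auto
      ultimately show ?thesis
        unfolding r_def r'_def congruent_strips_def by auto
    qed
    have "connected (F' k \<union> F (k + 1) \<union> t)" for k
    proof -
      \<comment> \<open>This is the lower end of \<open>F' k\<close> on the wall shared with the
        next strip; the later point \<open>p (of_int k + 1) (- of_int k - 2)\<close> lies on the
        boundary of \<open>t\<close>.\<close>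
      have "p (of_int k + 1) (- of_int k) \<in> F' k \<inter> F (k + 1)" by (simp add: F'_def F_def)
      then have FF: "connected (F' k \<union> F (k + 1))"
        by (intro connected_Un convex_connected convex_F) blast
      moreover have "p (of_int k + 1) (- of_int k - 2) \<in> F (k + 1) \<inter> t" by (simp add: t_def F_def)
      ultimately show ?thesis
        by (intro connected_Un[OF FF] convex_connected convex_t) blast
    qed
    moreover have "t \<noteq> {}" using int_t interior_subset by blast
    ultimately show ?thesis
      unfolding eq by (intro connected_Union) auto
  qed
  have far: "r' i \<inter> rc_times euclidean (r ((i + 1) mod 4)) (rc_minus euclidean (r' ((i + 1) mod 4))) = {}"
    if i: "i < 4" for i
  proof -
    let ?j = "(i + 1) mod 4"
    have "r ?j - r' ?j \<subseteq> congruent_strips ?j G"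
    proof
      fix x assume "x \<in> r ?j - r' ?j"
      then obtain k where k: "k mod 4 = int ?j" "x \<in> F k" "x \<notin> F' k"
        unfolding r_def r'_def congruent_strips_def by blast
      then have "x \<in> G k" by (auto simp: F'_def G_def)
      with k show "x \<in> congruent_strips ?j G" unfolding congruent_strips_def by blast
    qed
    then have "rc_times euclidean (r ?j) (rc_minus euclidean (r' ?j)) \<subseteq> congruent_strips ?j G"
      by (rule rc_times_minus_subset[OF _ closed_congruent_strips[OF closed_F(3) strip(3)]])
    \<comment> \<open>Sharing a point and having consecutive colours forces
      \<open>m = k + 1\<close>, but then the \<open>b\<close>-coordinate would be at least
      \<open>-k\<close> and at most \<open>-k - 1\<close>.\<close>
    moreover have False if x: "x \<in> r' i" "x \<in> congruent_strips ?j G" for x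
    proof -
      obtain k m where km: "k mod 4 = int i" "of_int k \<le> x $ a" "x $ a \<le> of_int k + 1" "- of_int k \<le> x $ b"
        "m mod 4 = int ?j" "of_int m \<le> x $ a" "x $ a \<le> of_int m + 1" "x $ b \<le> - of_int m"
        using x unfolding mem_r' congruent_strips_def G_def F_def by blast
      have "k - 1 \<le> m \<and> m \<le> k + 1" using near km by blast
      moreover have "m mod 4 = (k + 1) mod 4" using km(1,5) by (simp add: zmod_int) presburger
      ultimately have "m = k + 1" by presburger
      then show False using km(4,8) by simp
    qed
    ultimately show ?thesis by blast
  qed
  have "rc_interp euclidean r r' t"
    using rc_r rc_r' rc_t by (simp add: rc_interp_def)
  moreover have "phi_infty euclidean r r' t"
    unfolding phi_infty_def rc_plus_def rc_contact_def rc_conn_def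
  proof (intro conjI allI impI)
    show "r 0 \<union> r 1 \<union> r 2 \<union> r 3 = topspace euclidean" using cover by simp
    show "\<not> r 0 \<inter> r 2 \<noteq> {}" "\<not> r 1 \<inter> r 3 \<noteq> {}" using opposite by auto
    show "t \<noteq> {}" using int_t interior_subset by blast
    show "rc_times euclidean (r i) (r j) = {}" if "i < j \<and> j \<le> 3" for i j using that times0 by blast
    fix i :: nat assume "i \<le> 3"
    then have i: "i < 4" by simp
    show "r' i \<noteq> {}" "r i \<noteq> {}" using p_r'[OF i] sub by blast+
    show "rc_le euclidean (r' i) (r i)" by (rule le)
    show "connectedin euclidean (r' i \<union> r ((i + 1) mod 4) \<union> t)" using conn[OF i] by simp
    show "\<not> r' i \<inter> t \<noteq> {}" using r't by blast
    show "\<not> r' i \<inter> rc_times euclidean (r ((i + 1) mod 4)) (rc_minus euclidean (r' ((i + 1) mod 4))) \<noteq> {}"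
      using far[OF i] by blast
  qed
  ultimately show ?thesis by blast
qed

theorem theorem3p1:
  shows "(CARD('n) \<ge> 2 \<longrightarrow>
           (\<exists>r r' t. rc_interp (euclidean :: (real^'n) topology) r r' t \<and>
                     phi_infty euclidean r r' t))
       \<and> (\<forall>(X :: 'a topology) r r' t.
            locally_connected_space X \<and> unicoherent_space X \<and>
            rc_interp X r r' t \<and> phi_infty X r r' t \<longrightarrow>
            (\<exists>S \<in> r ` {..3} \<union> r' ` {..3} \<union> {t}.
               infinite (connected_components_of (subtopology X S))))"
  using phi_infty_satisfiable phi_infty_infinite_components by blast

end
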